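(* Let $f\in\mathrm{Hol}(\mathbb{D},\mathbb{D})$, and let $h\in\mathrm{Hol}(\mathbb{D},\mathbb{D})$ be a map for which there is a sequence $\{\gamma_n\}$ in $\mathrm{Aut}(\mathbb{D})$ with $\gamma_n^{-1}\circ f^n\to h$. Then $f$ is left semiconjugate in $\mathrm{Hol}(\mathbb{D},\mathbb{D})$ to a conformal automorphism of $\mathbb{D}$ if and only if $h$ is not constant.
   Context: $\mathbb{D}$ is the open unit disc; $\mathrm{Hol}(\mathbb{D},\mathbb{D})$ is the set of holomorphic self-maps of $\mathbb{D}$ (constants included) and $\mathrm{Aut}(\mathbb{D})$ the group of conformal automorphisms of $\mathbb{D}$. Here $f^n$ is the $n$-th iterate of $f$ and $\to$ denotes uniform convergence on compact subsets of $\mathbb{D}$. Such a map $h$ always exists and is unique up to left composition by elements of $\mathrm{Aut}(\mathbb{D})$. Given $f,g\in\mathrm{Hol}(\mathbb{D},\mathbb{D})$, $f$ is left semiconjugate in $\mathrm{Hol}(\mathbb{D},\mathbb{D})$ to $g$ if there is a nonconstant map $\phi\in\mathrm{Hol}(\mathbb{D},\mathbb{D})$ with $\phi\circ f=g\circ\phi$. *)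

theory Defs
  imports "HOL-Complex_Analysis.Complex_Analysis"
begin

text \<open>
  Self-maps of the unit disc are total functions on the complex plane of which only the values
  on the disc matter. All equations and limits below are therefore restricted to the disc.
\<close>

abbreviation unit_disc :: "complex set" where
  "unit_disc \<equiv> ball 0 1"

definition Hol_disc :: "(complex \<Rightarrow> complex) set" where
  "Hol_disc = {f. f holomorphic_on unit_disc \<and> f ` unit_disc \<subseteq> unit_disc}"

abbreviation disc_inv :: "(complex \<Rightarrow> complex) \<Rightarrow> complex \<Rightarrow> complex" where
  "disc_inv \<gamma> \<equiv> inv_into unit_disc \<gamma>"

definition Aut_disc :: "(complex \<Rightarrow> complex) set" where
  "Aut_disc = {\<gamma> \<in> Hol_disc. bij_betw \<gamma> unit_disc unit_disc \<and> disc_inv \<gamma> \<in> Hol_disc}"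

definition converges_compactly :: "(nat \<Rightarrow> complex \<Rightarrow> complex) \<Rightarrow> (complex \<Rightarrow> complex) \<Rightarrow> bool" where
  "converges_compactly F h \<longleftrightarrow>
     (\<forall>K. compact K \<and> K \<subseteq> unit_disc \<longrightarrow> uniform_limit K F h sequentially)"

definition left_semiconjugate :: "(complex \<Rightarrow> complex) \<Rightarrow> (complex \<Rightarrow> complex) \<Rightarrow> bool" where
  "left_semiconjugate f g \<longleftrightarrow>
     (\<exists>\<phi>\<in>Hol_disc. \<not> \<phi> constant_on unit_disc \<and> (\<forall>z\<in>unit_disc. (\<phi> \<circ> f) z = (g \<circ> \<phi>) z))"

end

theory Submission
  imports Defs
begin

text \<open>
  Write \<open>h\<^sub>n = \<gamma>\<^sub>n\<inverse> \<circ> f\<^sup>n\<close>, so that \<open>h\<^sub>n\<close> converges to \<open>h\<close>, and let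
  \<open>\<rho>(z, w) = |z - w| / |1 - cnj w z|\<close> be the pseudo-hyperbolic distance, which holomorphic
  self-maps of the disc do not increase (Schwarz--Pick) and automorphisms preserve.

  If \<open>\<phi> \<circ> f = g \<circ> \<phi>\<close> with an automorphism \<open>g\<close>, then \<open>\<phi> \<circ> f\<^sup>n = g\<^sup>n \<circ> \<phi>\<close>, and therefore
  \<open>\<rho>(\<phi> z, \<phi> w) = \<rho>(g\<^sup>n (\<phi> z), g\<^sup>n (\<phi> w)) = \<rho>(\<phi> (f\<^sup>n z), \<phi> (f\<^sup>n w)) \<le> \<rho>(f\<^sup>n z, f\<^sup>n w) = \<rho>(h\<^sub>n z, h\<^sub>n w)\<close>.
  The right-hand side tends to \<open>\<rho>(h z, h w)\<close>, so \<open>\<phi>\<close> is constant as soon as \<open>h\<close> is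
  (lemma \<open>semiconj_contracts\<close>).

  Conversely, a nonconstant \<open>h\<close> is itself a semiconjugacy. The automorphisms
  \<open>g\<^sub>n = \<gamma>\<^sub>n\<inverse> \<circ> \<gamma>\<^sub>n\<^sub>+\<^sub>1\<close> satisfy \<open>g\<^sub>n \<circ> h\<^sub>n\<^sub>+\<^sub>1 = h\<^sub>n \<circ> f\<close>. They are given by two parameters that range over a
  compact set, so a subsequence converges, either to an automorphism or to a constant of modulus 1.
  The second case cannot occur, because the limit maps the interior point \<open>h z\<close> to the interior
  point \<open>h (f z)\<close> (lemma \<open>Aut_disc_limit\<close>). In the first case the limit \<open>g\<close> satisfies
  \<open>g \<circ> h = h \<circ> f\<close>.
\<close>

section \<open>Self-maps and automorphisms of the disc\<close>

lemma Hol_disc_norm: "f \<in> Hol_disc \<Longrightarrow> norm z < 1 \<Longrightarrow> norm (f z) < 1"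
  by (auto simp: Hol_disc_def image_subset_iff)

lemma Hol_disc_comp:
  assumes "f \<in> Hol_disc" "g \<in> Hol_disc"
  shows "g \<circ> f \<in> Hol_disc"
  using assms unfolding Hol_disc_def
  by (auto intro!: holomorphic_on_compose_gen[where t = unit_disc])

lemma Hol_disc_funpow_norm: "f \<in> Hol_disc \<Longrightarrow> norm z < 1 \<Longrightarrow> norm ((f ^^ n) z) < 1"
  by (induction n) (auto intro: Hol_disc_norm)

lemma Aut_disc_Hol: "F \<in> Aut_disc \<Longrightarrow> F \<in> Hol_disc" "F \<in> Aut_disc \<Longrightarrow> disc_inv F \<in> Hol_disc"
  by (auto simp: Aut_disc_def)

lemma disc_inv_left: "F \<in> Aut_disc \<Longrightarrow> norm z < 1 \<Longrightarrow> disc_inv F (F z) = z"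
  by (auto simp: Aut_disc_def intro: bij_betw_inv_into_left)

lemma disc_inv_right: "F \<in> Aut_disc \<Longrightarrow> norm z < 1 \<Longrightarrow> F (disc_inv F z) = z"
  by (auto simp: Aut_disc_def intro: bij_betw_inv_into_right)

text \<open>
  Outside the disc \<open>disc_inv F\<close> need not agree with \<open>G\<close>; its holomorphy is transferred from \<open>G\<close>
  along their equality on the disc.
\<close>

lemma Aut_discI:
  assumes F: "F \<in> Hol_disc" and G: "G \<in> Hol_disc"
    and GF: "\<And>z. norm z < 1 \<Longrightarrow> G (F z) = z" and FG: "\<And>z. norm z < 1 \<Longrightarrow> F (G z) = z"
  shows "F \<in> Aut_disc"
proof -
  have bij: "bij_betw F unit_disc unit_disc"
    by (rule bij_betwI[where g = G]) (use assms in \<open>auto simp: Hol_disc_norm\<close>)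
  have eq: "disc_inv F z = G z" if "norm z < 1" for z
    using that bij_betw_inv_into_left[OF bij, of "G z"] FG[OF that] G
    by (auto simp: Hol_disc_norm)
  have "disc_inv F \<in> Hol_disc"
    using G holomorphic_cong[of unit_disc unit_disc "disc_inv F" G] eq
    by (auto simp: Hol_disc_def image_subset_iff)
  with bij F show ?thesis by (simp add: Aut_disc_def)
qed

lemma Aut_disc_comp:
  assumes "F \<in> Aut_disc" "G \<in> Aut_disc"
  shows "G \<circ> F \<in> Aut_disc"
  by (rule Aut_discI[where G = "disc_inv F \<circ> disc_inv G"])
     (use assms in \<open>auto intro!: Hol_disc_comp
        simp: Aut_disc_Hol Hol_disc_norm disc_inv_left disc_inv_right\<close>)

lemma Aut_disc_inv:
  assumes "F \<in> Aut_disc"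
  shows "disc_inv F \<in> Aut_disc"
  by (rule Aut_discI[where G = F])
     (use assms in \<open>auto simp: Aut_disc_Hol disc_inv_left disc_inv_right\<close>)

lemma Moebius_Hol_disc: "norm a < 1 \<Longrightarrow> Moebius_function t a \<in> Hol_disc"
  by (auto simp: Hol_disc_def image_subset_iff Moebius_function_holomorphic Moebius_function_norm_lt_1)

lemma one_minus_cnj_mult_nonzero:
  assumes "norm (a :: complex) \<le> 1" "norm z < 1"
  shows "1 - cnj a * z \<noteq> 0"
proof
  assume "1 - cnj a * z = 0"
  then have "norm a * norm z = 1"
    by (metis complex_mod_cnj norm_mult norm_one right_minus_eq)
  moreover have "norm a * norm z \<le> 1 * norm z"
    using assms by (intro mult_right_mono) auto
  ultimately show False using assms by simp
qed

lemma Moebius_eq_zero_iff: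
  assumes "norm a < 1" "norm z < 1"
  shows "Moebius_function 0 a z = 0 \<longleftrightarrow> z = a"
  using one_minus_cnj_mult_nonzero[of a z] assms by (simp add: Moebius_function_simple)

lemma rotated_Moebius_Aut_disc:
  assumes a: "norm a < 1" and u: "norm u = 1"
  shows "(\<lambda>z. u * Moebius_function 0 a z) \<in> Aut_disc"
proof (rule Aut_discI[where G = "\<lambda>z. Moebius_function 0 (-a) (z / u)"])
  note M = Moebius_Hol_disc[of a 0, unfolded Hol_disc_def] Moebius_Hol_disc[of "-a" 0]
  have u0: "u \<noteq> 0" using u by auto
  show "(\<lambda>z. u * Moebius_function 0 a z) \<in> Hol_disc"
    using M a u by (auto simp: Hol_disc_def image_subset_iff norm_mult intro!: holomorphic_intros)
  have "(\<lambda>z. z / u) \<in> Hol_disc"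
    using u u0 by (auto simp: Hol_disc_def image_subset_iff norm_divide intro!: holomorphic_intros)
  from Hol_disc_comp[OF this M(2)] a show "(\<lambda>z. Moebius_function 0 (-a) (z / u)) \<in> Hol_disc"
    by (simp add: o_def)
  show "Moebius_function 0 (-a) (u * Moebius_function 0 a z / u) = z" if "norm z < 1" for z
    using that a u0 by (simp add: Moebius_function_compose)
  show "u * Moebius_function 0 a (Moebius_function 0 (-a) (z / u)) = z" if "norm z < 1" for z
    using that a u u0 Moebius_function_compose[of a "-a" "z / u"] by (simp add: norm_divide)
qed

section \<open>The Schwarz--Pick lemma\<close>

text \<open>
  The quantity \<open>cmod (Moebius_function 0 w z)\<close> is the pseudo-hyperbolic distance of \<open>z\<close> and \<open>w\<close>.
  Moving \<open>w\<close> and \<open>f w\<close> to the origin by Moebius maps reduces the claim to the Schwarz lemma.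
\<close>

lemma Schwarz_Pick:
  assumes f: "f \<in> Hol_disc" and z: "norm z < 1" and w: "norm w < 1"
  shows "cmod (Moebius_function 0 (f w) (f z)) \<le> cmod (Moebius_function 0 w z)"
proof -
  define F where "F = Moebius_function 0 (f w) \<circ> (f \<circ> Moebius_function 0 (-w))"
  have fw: "norm (f w) < 1" using f w by (rule Hol_disc_norm)
  have F: "F \<in> Hol_disc"
    unfolding F_def using f w fw by (intro Hol_disc_comp Moebius_Hol_disc) auto
  have "norm (F (Moebius_function 0 w z)) \<le> norm (Moebius_function 0 w z)"
  proof (rule Schwarz_Lemma(1))
    show "F holomorphic_on ball 0 1" using F by (simp add: Hol_disc_def)
    show "F 0 = 0" by (simp add: F_def Moebius_function_of_zero Moebius_function_eq_zero)
  qed (use F z w in \<open>auto simp: Hol_disc_norm Moebius_function_norm_lt_1\<close>)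
  then show ?thesis
    using Moebius_function_compose[of "-w" w z] z w by (simp add: F_def)
qed

lemma Aut_disc_isometry:
  assumes F: "F \<in> Aut_disc" and z: "norm z < 1" and w: "norm w < 1"
  shows "cmod (Moebius_function 0 (F w) (F z)) = cmod (Moebius_function 0 w z)"
proof (rule antisym)
  show "cmod (Moebius_function 0 (F w) (F z)) \<le> cmod (Moebius_function 0 w z)"
    using F z w by (intro Schwarz_Pick Aut_disc_Hol)
  show "cmod (Moebius_function 0 w z) \<le> cmod (Moebius_function 0 (F w) (F z))"
    using Schwarz_Pick[OF Aut_disc_Hol(2)[OF F], of "F z" "F w"] F z w
    by (simp add: Hol_disc_norm Aut_disc_Hol disc_inv_left)
qed

text \<open>
  With \<open>a\<close> the zero of \<open>F\<close>, the isometry property reads \<open>|F z| = |Moebius_function 0 a z|\<close>.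
  Hence \<open>F\<close> composed with the inverse Moebius map preserves the modulus, and the equality case of
  the Schwarz lemma makes it a rotation.
\<close>

lemma Aut_disc_form:
  assumes F: "F \<in> Aut_disc"
  obtains u a where "norm u = 1" "norm a < 1"
    "\<And>z. norm z < 1 \<Longrightarrow> F z = u * Moebius_function 0 a z"
proof -
  define a where "a = disc_inv F 0"
  have a: "norm a < 1" unfolding a_def by (rule Hol_disc_norm[OF Aut_disc_Hol(2)[OF F]]) simp
  have Fa: "F a = 0" unfolding a_def using F by (simp add: disc_inv_right)
  define R where "R = F \<circ> Moebius_function 0 (-a)"
  have R: "R \<in> Hol_disc"
    unfolding R_def using F a by (intro Hol_disc_comp Moebius_Hol_disc Aut_disc_Hol) auto
  \<comment> \<open>The equality case needs a single nonzero point, here 1/2.\<close>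
  define b where "b = Moebius_function 0 (-a) (1/2)"
  have b: "norm b < 1" unfolding b_def using a by (intro Moebius_function_norm_lt_1) auto
  have "norm (F b) = norm (Moebius_function 0 a b)"
    using Aut_disc_isometry[OF F b a] Fa by (simp add: Moebius_function_simple[of 0])
  also have "Moebius_function 0 a b = 1/2"
    unfolding b_def using a by (intro Moebius_function_compose) auto
  finally have "norm (R (1/2)) = norm (1/2 :: complex)" by (simp add: R_def b_def)
  moreover have "R holomorphic_on ball 0 1" using R by (simp add: Hol_disc_def)
  moreover have "R 0 = 0" by (simp add: R_def Moebius_function_of_zero Fa)
  ultimately have "\<exists>\<alpha>. (\<forall>z. norm z < 1 \<longrightarrow> R z = \<alpha> * z) \<and> norm \<alpha> = 1"
    using R by (intro Schwarz_Lemma(3)[where \<xi> = 0] disjI1 exI[of _ "1/2"])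
      (auto simp: Hol_disc_norm)
  then obtain u where u: "norm u = 1" "\<And>z. norm z < 1 \<Longrightarrow> R z = u * z" by blast
  show thesis
  proof (rule that[OF u(1) a])
    fix z :: complex assume z: "norm z < 1"
    show "F z = u * Moebius_function 0 a z"
      using u(2)[of "Moebius_function 0 a z"] a z Moebius_function_compose[of "-a" a z]
      by (simp add: R_def Moebius_function_norm_lt_1)
  qed
qed

section \<open>Limits of automorphisms\<close>

text \<open>
  The parameters \<open>(u, a)\<close> of automorphisms accumulate at some \<open>(u, a)\<close> with \<open>|u| = 1\<close> and
  \<open>|a| \<le> 1\<close>. If \<open>|a| = 1\<close>, then \<open>|z - a| = |1 - cnj a z|\<close>, so the limit function would have modulus 1;
  a single point of the disc that is sent into the disc rules this out.
\<close>

lemma Aut_disc_limit: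
  fixes G v :: "nat \<Rightarrow> complex \<Rightarrow> complex"
  assumes G: "\<And>n. G n \<in> Aut_disc"
    and v: "\<And>n z. norm z < 1 \<Longrightarrow> norm (v n z) < 1"
    and vV: "\<And>z. norm z < 1 \<Longrightarrow> (\<lambda>n. v n z) \<longlonglongrightarrow> V z"
    and GU: "\<And>z. norm z < 1 \<Longrightarrow> (\<lambda>n. G n (v n z)) \<longlonglongrightarrow> U z"
    and V: "\<And>z. norm z < 1 \<Longrightarrow> norm (V z) < 1"
    and U: "\<And>z. norm z < 1 \<Longrightarrow> norm (U z) < 1"
  obtains g where "g \<in> Aut_disc" "\<And>z. norm z < 1 \<Longrightarrow> g (V z) = U z"
proof -
  have "\<exists>p. norm (fst p) = 1 \<and> norm (snd p) < 1 \<and>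
      (\<forall>z. norm z < 1 \<longrightarrow> G n z = fst p * Moebius_function 0 (snd p) z)" for n
    using Aut_disc_form[OF G[of n]] by (metis fst_conv snd_conv)
  then obtain p where p: "\<And>n. norm (fst (p n)) = 1" "\<And>n. norm (snd (p n)) < 1"
      "\<And>n z. norm z < 1 \<Longrightarrow> G n z = fst (p n) * Moebius_function 0 (snd (p n)) z"
    by metis
  have "compact (sphere (0::complex) 1 \<times> cball (0::complex) 1)"
    by (intro compact_Times compact_sphere compact_cball)
  moreover have "\<forall>n. p n \<in> sphere 0 1 \<times> cball 0 1"
    using p(1,2) by (simp add: mem_Times_iff less_imp_le)
  ultimately obtain l r where l: "l \<in> sphere 0 1 \<times> cball 0 1" and r: "strict_mono r"
    and lim: "(p \<circ> r) \<longlonglongrightarrow> l"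
    unfolding compact_def by metis
  obtain u a where ua: "l = (u, a)" by (cases l)
  have u: "norm u = 1" and a: "norm a \<le> 1" using l ua by auto
  have limu: "(\<lambda>n. fst (p (r n))) \<longlonglongrightarrow> u" and lima: "(\<lambda>n. snd (p (r n))) \<longlonglongrightarrow> a"
    using tendsto_fst[OF lim] tendsto_snd[OF lim] by (simp_all add: ua o_def)
  have key: "u * Moebius_function 0 a (V z) = U z" if z: "norm z < 1" for z
  proof (rule LIMSEQ_unique)
    have "(\<lambda>n. v (r n) z) \<longlonglongrightarrow> V z"
      using LIMSEQ_subseq_LIMSEQ[OF vV[OF z] r] by (simp add: o_def)
    then show "(\<lambda>n. fst (p (r n)) * Moebius_function 0 (snd (p (r n))) (v (r n) z))
        \<longlonglongrightarrow> u * Moebius_function 0 a (V z)"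
      unfolding Moebius_function_simple
      using limu lima one_minus_cnj_mult_nonzero[OF a V[OF z]] by (intro tendsto_intros) auto
    show "(\<lambda>n. fst (p (r n)) * Moebius_function 0 (snd (p (r n))) (v (r n) z)) \<longlonglongrightarrow> U z"
      using LIMSEQ_subseq_LIMSEQ[OF GU[OF z] r] p(3)[OF v[OF z]] by (simp add: o_def)
  qed
  have "norm a \<noteq> 1"
  proof
    assume a1: "norm a = 1"
    define w where "w = V 0"
    have "w - a = - a * (1 - cnj a * w)"
      using a1 complex_norm_square[of a] by (simp add: algebra_simps)
    then have "norm (w - a) = norm (1 - cnj a * w)"
      using a1 by (metis norm_mult norm_minus_cancel mult_1)
    then have "norm (u * Moebius_function 0 a w) = 1"
      using u one_minus_cnj_mult_nonzero[of a w] V[of 0] a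
      by (simp add: Moebius_function_simple norm_mult norm_divide w_def)
    then show False using key[of 0] U[of 0] by (simp add: w_def)
  qed
  with a have "norm a < 1" by simp
  from that[OF rotated_Moebius_Aut_disc[OF this u]] key show thesis by blast
qed

section \<open>Semiconjugacies and the limit map\<close>

lemma converges_compactly_pointwise:
  assumes "converges_compactly F h" "norm z < 1"
  shows "(\<lambda>n. F n z) \<longlonglongrightarrow> h z"
  using assms unfolding converges_compactly_def
  by (metis compact_sing empty_subsetI insert_subset mem_ball_0 uniform_limit_singleton)

lemma semiconj_funpow:
  assumes "f \<in> Hol_disc" "\<And>z. norm z < 1 \<Longrightarrow> \<phi> (f z) = g (\<phi> z)" "norm z < 1"
  shows "\<phi> ((f ^^ n) z) = (g ^^ n) (\<phi> z)"
  by (induction n) (use assms in \<open>auto simp: Hol_disc_funpow_norm\<close>)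

lemma Aut_disc_funpow_isometry:
  assumes F: "F \<in> Aut_disc" and z: "norm z < 1" and w: "norm w < 1"
  shows "cmod (Moebius_function 0 ((F ^^ n) w) ((F ^^ n) z)) = cmod (Moebius_function 0 w z)"
  by (induction n)
     (use F z w in \<open>auto simp: Aut_disc_isometry Hol_disc_funpow_norm Aut_disc_Hol\<close>)

text \<open>
  Iterating an automorphism loses no distance, so the distance that survives along the orbits of
  \<open>f\<close>, which the renormalization by \<open>\<gamma> n\<close> does not change, bounds that of the values of \<open>\<phi>\<close>.
\<close>

lemma semiconj_contracts:
  assumes f: "f \<in> Hol_disc" and h: "h \<in> Hol_disc" and \<gamma>: "\<And>n. \<gamma> n \<in> Aut_disc"
    and lim: "converges_compactly (\<lambda>n. disc_inv (\<gamma> n) \<circ> (f ^^ n)) h"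
    and g: "g \<in> Aut_disc" and \<phi>: "\<phi> \<in> Hol_disc"
    and semi: "\<And>z. norm z < 1 \<Longrightarrow> \<phi> (f z) = g (\<phi> z)"
    and z: "norm z < 1" and w: "norm w < 1"
  shows "cmod (Moebius_function 0 (\<phi> w) (\<phi> z)) \<le> cmod (Moebius_function 0 (h w) (h z))"
proof (rule LIMSEQ_le_const)
  define H where "H = (\<lambda>n. disc_inv (\<gamma> n) \<circ> (f ^^ n))"
  have "(\<lambda>n. H n x) \<longlonglongrightarrow> h x" if "norm x < 1" for x
    using converges_compactly_pointwise[OF lim that] by (simp add: H_def)
  then show "(\<lambda>n. cmod (Moebius_function 0 (H n w) (H n z)))
      \<longlonglongrightarrow> cmod (Moebius_function 0 (h w) (h z))"
    unfolding Moebius_function_simple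
    using z w h one_minus_cnj_mult_nonzero[of "h w" "h z"]
    by (intro tendsto_intros) (auto simp: Hol_disc_norm less_imp_le)
  have "cmod (Moebius_function 0 (\<phi> w) (\<phi> z)) \<le> cmod (Moebius_function 0 (H n w) (H n z))" for n
  proof -
    have fn: "norm ((f ^^ n) z) < 1" "norm ((f ^^ n) w) < 1"
      using f z w by (auto intro: Hol_disc_funpow_norm)
    have "cmod (Moebius_function 0 (\<phi> w) (\<phi> z))
        = cmod (Moebius_function 0 ((g ^^ n) (\<phi> w)) ((g ^^ n) (\<phi> z)))"
      using g \<phi> z w by (simp add: Aut_disc_funpow_isometry Hol_disc_norm)
    also have "\<dots> = cmod (Moebius_function 0 (\<phi> ((f ^^ n) w)) (\<phi> ((f ^^ n) z)))"
      using semiconj_funpow[of f \<phi> g] f semi z w by simp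
    also have "\<dots> \<le> cmod (Moebius_function 0 ((f ^^ n) w) ((f ^^ n) z))"
      using \<phi> fn by (rule Schwarz_Pick)
    also have "\<dots> = cmod (Moebius_function 0 (H n w) (H n z))"
      using Aut_disc_isometry[OF Aut_disc_inv[OF \<gamma>] fn] by (simp add: H_def)
    finally show ?thesis .
  qed
  then show "\<exists>N. \<forall>n\<ge>N. cmod (Moebius_function 0 (\<phi> w) (\<phi> z))
      \<le> cmod (Moebius_function 0 (H n w) (H n z))" by blast
qed

lemma limit_semiconj:
  assumes f: "f \<in> Hol_disc" and h: "h \<in> Hol_disc" and \<gamma>: "\<And>n. \<gamma> n \<in> Aut_disc"
    and lim: "converges_compactly (\<lambda>n. disc_inv (\<gamma> n) \<circ> (f ^^ n)) h"
  obtains g where "g \<in> Aut_disc" "\<And>z. norm z < 1 \<Longrightarrow> g (h z) = h (f z)"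
proof -
  define H where "H = (\<lambda>n. disc_inv (\<gamma> n) \<circ> (f ^^ n))"
  have H: "(\<lambda>n. H n z) \<longlonglongrightarrow> h z" if "norm z < 1" for z
    using converges_compactly_pointwise[OF lim that] by (simp add: H_def)
  have Hn: "norm (H n z) < 1" if "norm z < 1" for n z
    using that f \<gamma> by (simp add: H_def Hol_disc_norm Hol_disc_funpow_norm Aut_disc_Hol)
  define G where "G = (\<lambda>n. disc_inv (\<gamma> n) \<circ> \<gamma> (Suc n))"
  have GH: "G n (H (Suc n) z) = H n (f z)" if z: "norm z < 1" for n z
  proof -
    have "norm ((f ^^ Suc n) z) < 1" using f z by (rule Hol_disc_funpow_norm)
    then have "G n (H (Suc n) z) = disc_inv (\<gamma> n) ((f ^^ Suc n) z)"
      unfolding G_def H_def o_apply using disc_inv_right[OF \<gamma>[of "Suc n"]] by metis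
    then show ?thesis by (simp add: H_def funpow_swap1)
  qed
  show thesis
  proof (rule Aut_disc_limit[where G = G and v = "\<lambda>n. H (Suc n)" and V = h and U = "h \<circ> f"])
    show "G n \<in> Aut_disc" for n
      unfolding G_def by (intro Aut_disc_comp Aut_disc_inv \<gamma>)
    show "(\<lambda>n. H (Suc n) z) \<longlonglongrightarrow> h z" if "norm z < 1" for z
      using H[OF that] by (rule LIMSEQ_Suc)
    show "(\<lambda>n. G n (H (Suc n) z)) \<longlonglongrightarrow> (h \<circ> f) z" if "norm z < 1" for z
      using H[of "f z"] f that by (simp add: GH Hol_disc_norm)
  qed (use f h Hn that in \<open>auto simp: Hol_disc_norm\<close>)
qed

theorem corollaryD:
  fixes f h :: "complex \<Rightarrow> complex"
  assumes "f \<in> Hol_disc"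
    and "h \<in> Hol_disc"
    and "\<exists>\<gamma> :: nat \<Rightarrow> complex \<Rightarrow> complex. (\<forall>n. \<gamma> n \<in> Aut_disc) \<and>
           converges_compactly (\<lambda>n. disc_inv (\<gamma> n) \<circ> (f ^^ n)) h"
  shows "(\<exists>g\<in>Aut_disc. left_semiconjugate f g) \<longleftrightarrow> \<not> h constant_on unit_disc"
proof -
  obtain \<gamma> :: "nat \<Rightarrow> complex \<Rightarrow> complex" where \<gamma>: "\<And>n. \<gamma> n \<in> Aut_disc"
    and lim: "converges_compactly (\<lambda>n. disc_inv (\<gamma> n) \<circ> (f ^^ n)) h"
    using assms(3) by blast
  show ?thesis
  proof
    assume "\<exists>g\<in>Aut_disc. left_semiconjugate f g"
    then obtain g \<phi> where g: "g \<in> Aut_disc" and \<phi>: "\<phi> \<in> Hol_disc"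
      and nc: "\<not> \<phi> constant_on unit_disc"
      and semi: "\<And>z. norm z < 1 \<Longrightarrow> \<phi> (f z) = g (\<phi> z)"
      unfolding left_semiconjugate_def by auto
    show "\<not> h constant_on unit_disc"
    proof
      assume "h constant_on unit_disc"
      then obtain c where c: "\<And>z. norm z < 1 \<Longrightarrow> h z = c"
        unfolding constant_on_def by auto
      have "\<phi> z = \<phi> 0" if z: "norm z < 1" for z
      proof -
        have "cmod (Moebius_function 0 (\<phi> 0) (\<phi> z)) \<le> 0"
          using semiconj_contracts[OF assms(1,2) \<gamma> lim g \<phi> semi z, of 0] c z
          by (simp add: Moebius_function_eq_zero)
        then show ?thesis
          using \<phi> z by (simp add: Moebius_eq_zero_iff Hol_disc_norm)
      qed
      then show False using nc unfolding constant_on_def by (metis mem_ball_0)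
    qed
  next
    assume nc: "\<not> h constant_on unit_disc"
    obtain g where "g \<in> Aut_disc" "\<And>z. norm z < 1 \<Longrightarrow> g (h z) = h (f z)"
      using limit_semiconj[OF assms(1,2) \<gamma> lim] by blast
    then show "\<exists>g\<in>Aut_disc. left_semiconjugate f g"
      unfolding left_semiconjugate_def using assms(2) nc by (intro bexI[of _ g] bexI[of _ h]) auto
  qed
qed

end
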